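(* In the risk model with interest rate described in the context (including its standing assumptions on the process $Y$), suppose there exists a real number $l>0$ such that for all $t\ge 0$ the claim sizes $Z(t+l)$ and $Z(t)$ are identically distributed, and such that for any $t\ge 0$ $$e^{-r(t+l)}\Lambda'(t+l)\le e^{-r(t)}\Lambda'(t)\quad\text{and}\quad e^{-r(t+l)}p'(t+l)\ge e^{-r(t)}p'(t).$$ Put $L(Y(l)):=\sup\{h\ge 0:\ \mathbf{E}e^{hY(l)}\le 1\}$. Then for each $h\in[0,L(Y(l))]$ $$\sup_{t\ge 0}\mathbf{E}e^{hY(t)}=\sup_{0\le t\le l}\mathbf{E}e^{hY(t)},$$ and for any $u>0$ and $T\ge 0$, $$\psi(u,T)\le\mathbf{P}\Big(\sup_{0\le t\le T}Y(t)>u\Big)\le e^{-hu}\sup_{0\le t\le T}\mathbf{E}e^{hY(t)},\qquad \psi(u)\le\mathbf{P}\Big(\sup_{t\ge 0}Y(t)>u\Big)\le e^{-hu}\sup_{0\le t\le l}\mathbf{E}e^{hY(t)}.$$ In addition, for any $u>0$, $$\psi(u)\le\inf_{h\in[0,L(Y(l))]}\Big\{e^{-hu}\sup_{0\le t\le l}\mathbf{E}e^{hY(t)}\Big\}\le C_2e^{-L(Y(l))u},\qquad C_2:=\sup_{0\le t\le l}\mathbf{E}e^{L(Y(l))Y(t)}.$$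
   Context: Model B: $N(t)$, $t\ge 0$, is a non-homogeneous Poisson process with non-decreasing accumulated intensity function $\Lambda(t)=\mathbf{E}N(t)<\infty$, $N(0)=\Lambda(0)=0$, with claim times $T_j=\min\{t\ge 0:N(t)\ge j\}$. $Z(t)\ge 0$ denotes the claim size in case a claim arrives at time $t$; $N(\cdot)$ and $Z(\cdot)$ are independent, and the $Z(T_j)$, $j\ge1$, are independent but not necessarily identically distributed. $p(t)\ge 0$ is the non-decreasing aggregate premium income over $[0,t]$, and $q(t)$ is the total claim amount over $[0,t]$ (the principal case being $q(t)=\sum_{j=1}^{N(t)}Z(T_j)$). The risk reserve process $R$, with $R(0)=u>0$, satisfies for all $t_2>t_1\ge 0$ $$R(t_2)=(1+\alpha(t_1,t_2))R(t_1)+(1+\beta(t_1,t_2))[p(t_2)-p(t_1)]-[q(t_2)-q(t_1)],$$ where $\beta(t_1,t_2)\ge 0$ and $1+\alpha(t_1,t_2)\ge e^{r(t_2)-r(t_1)}$ for a non-random non-decreasing function $r$ with $r(0)=0$. Put $S(t)=q(t)-p(t)$, assumed of bounded variation on finite intervals, and $Y(t)=\int_0^te^{-r(x)}\,dS(x)$, so $Y(0)=0$. The ruin probabilities are $\psi(u)=\mathbf{P}(\inf_{t\ge 0}R(t)<0)$ and $\psi(u,T)=\mathbf{P}(\inf_{0\le t\le T}R(t)<0)$. Standing assumptions: (i) $e^{-r(t)}R(t)\ge u-Y(t)$ for all $t>0$; (ii) $Y$ is a separable process (in Doob's sense) with independent increments; (iii) $\Lambda$ has a density $\Lambda'\ge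 0$ and $p$ has a density $p'\ge0$, and for all $h\ge0$, $t>0$, $$\mathbf{E}e^{hY(t)}=\exp\Big\{-\int_0^the^{-r(x)}p'(x)\,dx+\int_0^t\big(\mathbf{E}e^{he^{-r(x)}Z(x)}-1\big)\Lambda'(x)\,dx\Big\}.$$ Exponential moments may equal $+\infty$. If $L(Y(l))=\infty$, the interval $[0,L(Y(l))]$ is read as $[0,\infty)$ and the last inequality (the one with $C_2$) is not asserted. *)

theory Defs
  imports "HOL-Probability.Probability"
begin

section \<open>Lebesgue-Stieltjes integrals against functions of bounded variation\<close>

definition variation_sums :: "(real \<Rightarrow> real) \<Rightarrow> real \<Rightarrow> real \<Rightarrow> real set" where
  "variation_sums g a b =
     {(\<Sum>i<n. \<bar>g (x (Suc i)) - g (x i)\<bar>) | (n :: nat) x. mono x \<and> range x \<subseteq> {a..b}}"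

definition has_bounded_variation :: "(real \<Rightarrow> real) \<Rightarrow> real \<Rightarrow> real \<Rightarrow> bool" where
  "has_bounded_variation g a b \<longleftrightarrow> bdd_above (variation_sums g a b)"

definition total_variation :: "(real \<Rightarrow> real) \<Rightarrow> real \<Rightarrow> real \<Rightarrow> real" where
  "total_variation g a b = Sup (variation_sums g a b)"

text \<open>
  The integral of \<open>f\<close> over \<open>[a,b]\<close> with respect to the signed measure of \<open>g\<close>.
  The function \<open>g\<close> is continued constantly to the left of \<open>a\<close> and to the right of \<open>b\<close>, and
  written as the difference \<open>V - U\<close> of the two non-decreasing functions of its Jordan
  decomposition; each of them generates a measure through its right limits. For
  right-continuous \<open>g\<close> there is no mass at \<open>a\<close>, so that this is the usual integral
  over the half-open interval from \<open>a\<close> (excluded) to \<open>b\<close> (included).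
\<close>

definition stieltjes_integral ::
    "(real \<Rightarrow> real) \<Rightarrow> (real \<Rightarrow> real) \<Rightarrow> real \<Rightarrow> real \<Rightarrow> real" where
  "stieltjes_integral f g a b =
    (let c = (\<lambda>x. max a (min b x));
         V = (\<lambda>x. total_variation g a (c x));
         U = (\<lambda>x. V x - g (c x))
     in (LINT x:{a..b} | interval_measure (\<lambda>x. Lim (at_right x) V). f x)
        - (LINT x:{a..b} | interval_measure (\<lambda>x. Lim (at_right x) U). f x))"


section \<open>Stochastic processes on the half line\<close>

definition independent_increments :: "'a measure \<Rightarrow> (real \<Rightarrow> 'a \<Rightarrow> real) \<Rightarrow> bool" where
  "independent_increments M X \<longleftrightarrow>
    (\<forall>(n :: nat) (t :: nat \<Rightarrow> real). mono t \<and> 0 \<le> t 0 \<longrightarrow>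
      prob_space.indep_vars M (\<lambda>_. borel) (\<lambda>i \<omega>. X (t (Suc i)) \<omega> - X (t i) \<omega>) {..<n})"

text \<open>
  Doob's separability (relative to the possibly unbounded closed intervals \<open>A\<close>).
\<close>

definition separable_process :: "'a measure \<Rightarrow> (real \<Rightarrow> 'a \<Rightarrow> real) \<Rightarrow> bool" where
  "separable_process M X \<longleftrightarrow>
    (\<exists>D K. countable D \<and> D \<subseteq> {0..} \<and> K \<in> null_sets M \<and>
      (\<forall>a b A. closed A \<and> is_interval A \<longrightarrow>
        {\<omega> \<in> space M. \<forall>t\<in>{a<..<b} \<inter> D. X t \<omega> \<in> A}
          - {\<omega> \<in> space M. \<forall>t\<in>{a<..<b} \<inter> {0..}. X t \<omega> \<in> A} \<subseteq> K))"

definition poisson_process ::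
    "'a measure \<Rightarrow> (real \<Rightarrow> real) \<Rightarrow> (real \<Rightarrow> 'a \<Rightarrow> nat) \<Rightarrow> bool" where
  "poisson_process M \<Lambda> N \<longleftrightarrow>
    (\<forall>t\<ge>0. N t \<in> measurable M (count_space UNIV)) \<and>
    (AE \<omega> in M. N 0 \<omega> = 0 \<and> mono_on {0..} (\<lambda>t. N t \<omega>) \<and>
       (\<forall>t\<ge>0. continuous (at_right t) (\<lambda>s. real (N s \<omega>)))) \<and>
    independent_increments M (\<lambda>t \<omega>. real (N t \<omega>)) \<and>
    (\<forall>s t k. 0 \<le> s \<and> s \<le> t \<longrightarrow>
       measure M {\<omega> \<in> space M. N t \<omega> = N s \<omega> + k}
         = exp (- (\<Lambda> t - \<Lambda> s)) * (\<Lambda> t - \<Lambda> s) ^ k / fact k)"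

text \<open>Only meaningful for paths with at least \<open>j\<close> claims.\<close>

definition claim_time :: "(real \<Rightarrow> 'a \<Rightarrow> nat) \<Rightarrow> nat \<Rightarrow> 'a \<Rightarrow> real" where
  "claim_time N j \<omega> = (LEAST t. 0 \<le> t \<and> j \<le> N t \<omega>)"

definition has_density_on_half_line :: "(real \<Rightarrow> real) \<Rightarrow> (real \<Rightarrow> real) \<Rightarrow> bool" where
  "has_density_on_half_line F f \<longleftrightarrow>
    (\<forall>t\<ge>0. 0 \<le> f t \<and> set_integrable lborel {0..t} f \<and> F t = F 0 + (LBINT x:{0..t}. f x))"

definition exp_moment :: "'a measure \<Rightarrow> real \<Rightarrow> ('a \<Rightarrow> real) \<Rightarrow> ennreal" where
  "exp_moment M h X = (\<integral>\<^sup>+ \<omega>. ennreal (exp (h * X \<omega>)) \<partial>M)"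

definition exp_ereal :: "ereal \<Rightarrow> ennreal" where
  "exp_ereal x =
     (if x = \<infinity> then \<infinity> else if x = -\<infinity> then 0 else ennreal (exp (real_of_ereal x)))"


section \<open>The risk model with interest\<close>

text \<open>Probabilities are taken with respect to the completed measure: the events below involve
  uncountably many times, and a separable process makes its event measurable only up to a
  subset of a null set.\<close>

definition ruin_event :: "'a measure \<Rightarrow> (real \<Rightarrow> 'a \<Rightarrow> real) \<Rightarrow> real set \<Rightarrow> 'a set" where
  "ruin_event M X I = {\<omega> \<in> space M. (INF t\<in>I. ereal (X t \<omega>)) < 0}"

definition ruin_prob :: "'a measure \<Rightarrow> (real \<Rightarrow> 'a \<Rightarrow> real) \<Rightarrow> ennreal" where
  "ruin_prob M X = emeasure (completion M) (ruin_event M X {0..})"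

definition ruin_prob_upto :: "'a measure \<Rightarrow> (real \<Rightarrow> 'a \<Rightarrow> real) \<Rightarrow> real \<Rightarrow> ennreal" where
  "ruin_prob_upto M X T = emeasure (completion M) (ruin_event M X {0..T})"

definition sup_exceedance_prob ::
    "'a measure \<Rightarrow> (real \<Rightarrow> 'a \<Rightarrow> real) \<Rightarrow> real set \<Rightarrow> real \<Rightarrow> ennreal" where
  "sup_exceedance_prob M X I u =
     emeasure (completion M) {\<omega> \<in> space M. (SUP t\<in>I. ereal (X t \<omega>)) > ereal u}"

definition discounted_loss ::
    "(real \<Rightarrow> real) \<Rightarrow> (real \<Rightarrow> real) \<Rightarrow> (real \<Rightarrow> 'a \<Rightarrow> real) \<Rightarrow> real \<Rightarrow> 'a \<Rightarrow> real" where
  "discounted_loss r p q t \<omega> =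
     stieltjes_integral (\<lambda>x. exp (- r x)) (\<lambda>x. q x \<omega> - p x) 0 t"

text \<open>
  \<open>R u\<close> is the risk reserve process with initial capital \<open>u\<close>; the random rates
  \<open>\<alpha> u\<close> and \<open>\<beta> u\<close> may depend on \<open>u\<close>. The total claim amount \<open>q\<close> is not required to have
  the principal form \<open>q(t) = Z(T_1) + ... + Z(T_N(t))\<close>; it is tied to \<open>N\<close> and \<open>Z\<close> only
  through the exponential moment formula assumed later on. In \<open>claim_sizes\<close> the variable
  \<open>X j\<close> is \<open>Z(T_j)\<close>, its values being immaterial where fewer than \<open>j\<close> claims ever occur.
\<close>

locale interest_risk_model = prob_space M
  for M :: "'a measure" +
  fixes N :: "real \<Rightarrow> 'a \<Rightarrow> nat"
    and \<Lambda> :: "real \<Rightarrow> real"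
    and Z :: "real \<Rightarrow> 'a \<Rightarrow> real"
    and p :: "real \<Rightarrow> real"
    and q :: "real \<Rightarrow> 'a \<Rightarrow> real"
    and r :: "real \<Rightarrow> real"
    and \<alpha> \<beta> :: "real \<Rightarrow> real \<Rightarrow> real \<Rightarrow> 'a \<Rightarrow> real"
    and R :: "real \<Rightarrow> real \<Rightarrow> 'a \<Rightarrow> real"
  assumes claim_numbers: "poisson_process M \<Lambda> N"
    and intensity_zero: "\<Lambda> 0 = 0"
    and intensity_mono: "mono_on {0..} \<Lambda>"
    and intensity_expectation:
      "\<And>t. 0 \<le> t \<Longrightarrow> integrable M (\<lambda>\<omega>. real (N t \<omega>)) \<and> \<Lambda> t = expectation (\<lambda>\<omega>. real (N t \<omega>))"
    and claim_size_measurable: "\<And>t. 0 \<le> t \<Longrightarrow> Z t \<in> borel_measurable M"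
    and claim_size_nonneg: "\<And>t. 0 \<le> t \<Longrightarrow> AE \<omega> in M. 0 \<le> Z t \<omega>"
    and claim_numbers_sizes_indep:
      "indep_var (PiM {0..} (\<lambda>_. count_space UNIV)) (\<lambda>\<omega>. \<lambda>t\<in>{0..}. N t \<omega>)
                 (PiM {0..} (\<lambda>_. borel)) (\<lambda>\<omega>. \<lambda>t\<in>{0..}. Z t \<omega>)"
    and claim_sizes:
      "\<exists>X :: nat \<Rightarrow> 'a \<Rightarrow> real. indep_vars (\<lambda>_. borel) X {1..} \<and>
         (AE \<omega> in M. \<forall>j\<ge>1. (\<exists>t\<ge>0. j \<le> N t \<omega>) \<longrightarrow> X j \<omega> = Z (claim_time N j \<omega>) \<omega>)"
    and premium_nonneg: "\<And>t. 0 \<le> t \<Longrightarrow> 0 \<le> p t"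
    and premium_mono: "mono_on {0..} p"
    and total_claims_measurable: "\<And>t. 0 \<le> t \<Longrightarrow> q t \<in> borel_measurable M"
    and loss_bounded_variation:
      "AE \<omega> in M. \<forall>t\<ge>0. has_bounded_variation (\<lambda>x. q x \<omega> - p x) 0 t"
    and interest_zero: "r 0 = 0"
    and interest_mono: "mono_on {0..} r"
    and reserve_measurable: "\<And>u t. 0 < u \<Longrightarrow> 0 \<le> t \<Longrightarrow> R u t \<in> borel_measurable M"
    and reserve_initial: "\<And>u. 0 < u \<Longrightarrow> AE \<omega> in M. R u 0 \<omega> = u"
    and rates:
      "\<And>u. 0 < u \<Longrightarrow> AE \<omega> in M. \<forall>t1 t2. 0 \<le> t1 \<and> t1 < t2 \<longrightarrow>
         exp (r t2 - r t1) \<le> 1 + \<alpha> u t1 t2 \<omega> \<and> 0 \<le> \<beta> u t1 t2 \<omega>"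
    and reserve_dynamics:
      "\<And>u. 0 < u \<Longrightarrow> AE \<omega> in M. \<forall>t1 t2. 0 \<le> t1 \<and> t1 < t2 \<longrightarrow>
         R u t2 \<omega> = (1 + \<alpha> u t1 t2 \<omega>) * R u t1 \<omega> + (1 + \<beta> u t1 t2 \<omega>) * (p t2 - p t1)
                     - (q t2 \<omega> - q t1 \<omega>)"
    \<comment> \<open>so that the probabilities of ruin make sense\<close>
    and ruin_events_measurable:
      "\<And>u T. 0 < u \<Longrightarrow> 0 \<le> T \<Longrightarrow> ruin_event M (R u) {0..T} \<in> sets (completion M)"

text \<open>
  In \<open>exp_moment_formula\<close> the expectation inside the integral is at least one, so the
  subtraction in \<open>ennreal\<close> is exact; \<open>integrand_measurable\<close> makes this integral meaningful.
\<close>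

locale interest_risk_model_standing = interest_risk_model M N \<Lambda> Z p q r \<alpha> \<beta> R
  for M :: "'a measure" and N \<Lambda> Z p q r \<alpha> \<beta> R +
  fixes \<Lambda>' p' :: "real \<Rightarrow> real"
  assumes discounted_reserve_bound:
      "\<And>u. 0 < u \<Longrightarrow> AE \<omega> in M. \<forall>t>0. exp (- r t) * R u t \<omega> \<ge> u - discounted_loss r p q t \<omega>"
    and separable: "separable_process M (discounted_loss r p q)"
    and indep_increments: "independent_increments M (discounted_loss r p q)"
    and intensity_density: "has_density_on_half_line \<Lambda> \<Lambda>'"
    and premium_density: "has_density_on_half_line p p'"
    and integrand_measurable:
      "\<And>h. 0 \<le> h \<Longrightarrow>
         (\<lambda>x. (exp_moment M (h * exp (- r x)) (Z x) - 1) * ennreal (\<Lambda>' x))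
           \<in> borel_measurable (restrict_space borel {0..})"
    and exp_moment_formula:
      "\<And>h t. 0 \<le> h \<Longrightarrow> 0 < t \<Longrightarrow>
         exp_moment M h (discounted_loss r p q t) =
           exp_ereal (- ereal (LBINT x:{0..t}. h * exp (- r x) * p' x)
             + enn2ereal (\<integral>\<^sup>+ x\<in>{0..t}. (exp_moment M (h * exp (- r x)) (Z x) - 1)
                                           * ennreal (\<Lambda>' x) \<partial>lborel))"

end

theory Submission
  imports Defs
begin

text \<open>
  Periodicity and the growth conditions make the exponent of the moment formula for \<open>Y (t + l)\<close>
  at most the sum of those for \<open>Y l\<close> and \<open>Y t\<close>: the factor lost when \<open>exp (- r x)\<close> decreases to
  \<open>exp (- r (x + l))\<close> can be moved out of the claim moments because \<open>h \<mapsto> E exp (h Z) - 1\<close> is convex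
  and vanishes at zero. Hence the moments of \<open>Y\<close> do not increase along steps of length \<open>l\<close> as soon
  as \<open>E exp (h Y l) \<le> 1\<close>. The tail bounds come from a maximal inequality for exponential moments
  of processes with independent increments, transferred from finite sets of times to intervals by
  separability.
\<close>

section \<open>Integrals over an interval prolonged by one period\<close>

text \<open>The interval is cut at \<open>l\<close> and the piece beyond \<open>l\<close> is
  translated back by \<open>l\<close>, where the values can only be larger. This serves the claim
  term of the exponent, which may be infinite.\<close>

lemma nn_integral_shift_subadditive:
  fixes f :: "real \<Rightarrow> ennreal" and l t :: real
  assumes meas: "f \<in> borel_measurable (restrict_space borel {0..})"
    and "0 \<le> l"
    and le: "\<And>x. 0 \<le> x \<Longrightarrow> f (x + l) \<le> f x"
  shows "(\<integral>\<^sup>+ x\<in>{0..t + l}. f x \<partial>lborel)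
      \<le> (\<integral>\<^sup>+ x\<in>{0..l}. f x \<partial>lborel) + (\<integral>\<^sup>+ x\<in>{0..t}. f x \<partial>lborel)"
proof -
  \<comment> \<open>Measurability is given on the half line only; the cut-off function is Borel on
    the whole line, as the affine substitution requires.\<close>
  define g where "g x = f x * indicator {0..} x" for x
  have g [measurable]: "g \<in> borel_measurable borel"
    using meas unfolding g_def by (subst (asm) borel_measurable_restrict_space_iff_ennreal) auto
  have cut: "f x * indicator {0..b} x = g x * indicator {0..b} x" for x b
    by (auto simp: g_def split: split_indicator)
  have "(\<integral>\<^sup>+ x\<in>{0..t + l}. g x \<partial>lborel)
      \<le> (\<integral>\<^sup>+ x. g x * indicator {0..l} x + g x * indicator {l..t + l} x \<partial>lborel)"
    by (intro nn_integral_mono) (auto split: split_indicator)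
  also have "\<dots> = (\<integral>\<^sup>+ x\<in>{0..l}. g x \<partial>lborel) + (\<integral>\<^sup>+ x\<in>{l..t + l}. g x \<partial>lborel)"
    by (intro nn_integral_add) auto
  also have "(\<integral>\<^sup>+ x\<in>{l..t + l}. g x \<partial>lborel)
      = (\<integral>\<^sup>+ x. g (l + 1 * x) * indicator {l..t + l} (l + 1 * x) \<partial>lborel)"
    by (subst nn_integral_real_affine[where c = 1 and t = l]) auto
  also have "\<dots> \<le> (\<integral>\<^sup>+ x\<in>{0..t}. g x \<partial>lborel)"
    using le \<open>0 \<le> l\<close>
    by (intro nn_integral_mono) (auto simp: g_def add.commute split: split_indicator)
  finally show ?thesis
    unfolding cut by (simp add: add_left_mono)
qed

text \<open>The mirror image for the premium term: the same cut and translation, but with Bochner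
  integrals, so integrability has to be carried along.\<close>

lemma set_integral_shift_superadditive:
  fixes f :: "real \<Rightarrow> real" and l t :: real
  assumes int: "\<And>b. set_integrable lborel {0..b} f"
    and "0 \<le> l" "0 \<le> t"
    and le: "\<And>x. 0 \<le> x \<Longrightarrow> f x \<le> f (x + l)"
  shows "(LBINT x:{0..l}. f x) + (LBINT x:{0..t}. f x) \<le> (LBINT x:{0..t + l}. f x)"
proof -
  have int': "set_integrable lborel {l..t + l} f"
    by (rule set_integrable_subset[OF int[of "t + l"]]) (use \<open>0 \<le> l\<close> in auto)
  have shift: "integrable lborel (\<lambda>x. indicat_real {l..t + l} (l + 1 * x) *\<^sub>R f (l + 1 * x))"
    by (rule lborel_integrable_real_affine) (use int' in \<open>auto simp: set_integrable_def\<close>)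
  have "(LBINT x:{0..t}. f x)
      \<le> (\<integral>x. indicat_real {l..t + l} (l + 1 * x) *\<^sub>R f (l + 1 * x) \<partial>lborel)"
    unfolding set_lebesgue_integral_def
    using le int[of t] shift
    by (intro integral_mono) (auto simp: set_integrable_def add.commute split: split_indicator)
  also have "\<dots> = (LBINT x:{l..t + l}. f x)"
    unfolding set_lebesgue_integral_def
    by (subst lborel_integral_real_affine[where c = 1 and t = l]) auto
  finally have "(LBINT x:{0..l}. f x) + (LBINT x:{0..t}. f x)
      \<le> (LBINT x:{0..l}. f x) + (LBINT x:{l..t + l}. f x)" by simp
  \<comment> \<open>The two pieces overlap only in the Lebesgue null set \<open>{l}\<close>.\<close>
  also have "\<dots> = (LBINT x:{0..l} \<union> {l..t + l}. f x)"
    by (rule set_integral_Un_AE[symmetric, OF _ _ _ int int'])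
       (auto intro!: eventually_mono[OF AE_lborel_singleton[of l]])
  also have "{0..l} \<union> {l..t + l} = {0..t + l}"
    using \<open>0 \<le> l\<close> \<open>0 \<le> t\<close> by auto
  finally show ?thesis .
qed

section \<open>Convexity of exponential moments\<close>

lemma exp_moment_zero: "prob_space M \<Longrightarrow> exp_moment M 0 X = 1"
  by (simp add: exp_moment_def prob_space.emeasure_space_1)

lemma exp_mult_le_convex_comb:
  fixes c y :: real
  assumes "0 \<le> c" "c \<le> 1"
  shows "exp (c * y) \<le> 1 - c + c * exp y"
  using convex_onD[OF exp_convex, of c 0 y] assms by simp

text \<open>The chord bound for \<open>exp\<close> between \<open>0\<close> and
  \<open>h * X \<omega>\<close> is integrated; total mass one supplies the constant term. Infinite
  moments are allowed.\<close>

lemma (in prob_space) exp_moment_mult_le_convex_comb: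
  assumes [measurable]: "X \<in> borel_measurable M" and c: "0 \<le> c" "c \<le> 1"
  shows "exp_moment M (c * h) X \<le> ennreal (1 - c) + ennreal c * exp_moment M h X"
proof -
  have "exp_moment M (c * h) X
      \<le> (\<integral>\<^sup>+ \<omega>. ennreal (1 - c) + ennreal c * ennreal (exp (h * X \<omega>)) \<partial>M)"
    unfolding exp_moment_def
  proof (intro nn_integral_mono)
    fix \<omega>
    have "exp (c * h * X \<omega>) \<le> (1 - c) + c * exp (h * X \<omega>)"
      using exp_mult_le_convex_comb[OF c, of "h * X \<omega>"] by (simp add: mult.assoc)
    then show "ennreal (exp (c * h * X \<omega>)) \<le> ennreal (1 - c) + ennreal c * ennreal (exp (h * X \<omega>))"
      using c by (simp flip: ennreal_plus ennreal_mult)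
  qed
  also have "\<dots> = ennreal (1 - c) + ennreal c * exp_moment M h X"
    unfolding exp_moment_def
    by (subst nn_integral_add) (auto simp: nn_integral_cmult emeasure_space_1)
  finally show ?thesis .
qed

text \<open>Convexity combined with the value zero at parameter zero. In this form a discount factor
  \<open>c\<close> can be taken out of the claim moments.\<close>

lemma (in prob_space) exp_moment_minus_one_mult_le:
  assumes "X \<in> borel_measurable M" and c: "0 \<le> c" "c \<le> 1"
  shows "exp_moment M (c * h) X - 1 \<le> ennreal c * (exp_moment M h X - 1)"
proof -
  \<comment> \<open>Subtraction in \<open>ennreal\<close> truncates at zero and the moment may lie
    below one, hence an inequality.\<close>
  have "exp_moment M h X \<le> 1 + (exp_moment M h X - 1)"
    by (meson diff_add_self_ennreal ennreal_minus_le_iff order_refl)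
  then have "exp_moment M (c * h) X \<le> ennreal (1 - c) + ennreal c * (1 + (exp_moment M h X - 1))"
    by (intro order_trans[OF exp_moment_mult_le_convex_comb[OF assms]] add_left_mono mult_left_mono) auto
  also have "\<dots> = (ennreal (1 - c) + ennreal c) + ennreal c * (exp_moment M h X - 1)"
    by (simp add: distrib_left add.assoc)
  also have "ennreal (1 - c) + ennreal c = 1"
    using c by (simp flip: ennreal_plus)
  finally show ?thesis
    by (auto simp: ennreal_minus_le_iff)
qed

text \<open>The set of \<open>h \<ge> 0\<close> with exponential moment at most one is an interval by convexity and
  closed by Fatou's lemma, so that it contains its supremum.\<close>

lemma (in prob_space) exp_moment_le_one_upto_Sup:
  assumes X [measurable]: "X \<in> borel_measurable M" and "0 \<le> h"
    and h: "ereal h \<le> (SUP h\<in>{h. 0 \<le> h \<and> exp_moment M h X \<le> 1}. ereal h)"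
  shows "exp_moment M h X \<le> 1"
proof (cases "h = 0")
  case True
  then show ?thesis
    by (simp add: exp_moment_zero prob_space_axioms)
next
  case False
  with \<open>0 \<le> h\<close> have "0 < h" by simp
  have below: "exp_moment M k X \<le> 1" if k: "0 \<le> k" "k < h" for k
  proof -
    have "ereal k < (SUP h\<in>{h. 0 \<le> h \<and> exp_moment M h X \<le> 1}. ereal h)"
      using k h by (meson ereal_less_eq(3) less_ereal.simps(1) order_less_le_trans)
    \<comment> \<open>Since \<open>k\<close> is strictly below the supremum, some admissible
      \<open>m\<close> exceeds it, and \<open>k\<close> is a convex combination of \<open>0\<close>
      and \<open>m\<close>.\<close>
    then obtain m where m: "k < m" "exp_moment M m X \<le> 1" "0 \<le> m"
      by (auto simp: less_SUP_iff)
    have "exp_moment M (k / m * m) X \<le> ennreal (1 - k / m) + ennreal (k / m) * exp_moment M m X"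
      using k m by (intro exp_moment_mult_le_convex_comb) auto
    also have "\<dots> \<le> ennreal (1 - k / m) + ennreal (k / m) * 1"
      using m by (intro add_left_mono mult_left_mono) auto
    also have "\<dots> = 1"
      using k m by (simp flip: ennreal_plus)
    finally show ?thesis
      using k m by simp
  qed
  \<comment> \<open>The \<open>c n\<close> tend to \<open>h\<close> from strictly below, so
    \<open>below\<close> applies to each of them and Fatou's lemma carries the bound to
    \<open>h\<close> itself.\<close>
  define c where "c n = h * (1 - 1 / real (Suc n))" for n
  have "c \<longlonglongrightarrow> h * (1 - 0)"
    unfolding c_def by (intro tendsto_intros LIMSEQ_Suc lim_1_over_n)
  then have lim: "(\<lambda>n. ennreal (exp (c n * X \<omega>))) \<longlonglongrightarrow> ennreal (exp (h * X \<omega>))" for \<omega>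
    by (intro tendsto_intros) auto
  have "exp_moment M h X = (\<integral>\<^sup>+ \<omega>. liminf (\<lambda>n. ennreal (exp (c n * X \<omega>))) \<partial>M)"
    unfolding exp_moment_def
    by (intro nn_integral_cong lim_imp_Liminf[symmetric] lim) auto
  also have "\<dots> \<le> liminf (\<lambda>n. exp_moment M (c n) X)"
    unfolding exp_moment_def by (intro nn_integral_liminf) auto
  also have "\<dots> \<le> liminf (\<lambda>n. 1)"
  proof (intro Liminf_mono always_eventually allI below)
    show "0 \<le> c n" "c n < h" for n
      using \<open>0 < h\<close> by (auto simp: c_def field_simps)
  qed
  finally show ?thesis
    by (simp add: Liminf_const)
qed

text \<open>The pairs \<open>a0, b0\<close> and \<open>a, b1\<close> and \<open>a2, b2\<close> stand
  for the premium and claim terms of \<open>Y l\<close>, \<open>Y t\<close> and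
  \<open>Y (t + l)\<close>. The last exponent is at most the sum of the other two, and the first of
  these is nonpositive. An infinite \<open>b1\<close> makes the right side infinite and an infinite
  \<open>b0\<close> contradicts the first assumption, so only finite terms are ever added.\<close>

lemma exp_ereal_le_of_split:
  fixes a0 a a2 :: real and b0 b1 b2 :: ennreal
  assumes "exp_ereal (- ereal a0 + enn2ereal b0) \<le> 1"
    and "a0 + a \<le> a2" and "b2 \<le> b0 + b1"
  shows "exp_ereal (- ereal a2 + enn2ereal b2) \<le> exp_ereal (- ereal a + enn2ereal b1)"
proof (cases b1)
  case (real c1)
  show ?thesis
  proof (cases b0)
    case (real c0)
    with \<open>b1 = ennreal c1\<close> \<open>0 \<le> c1\<close> assms(3) have "b2 \<le> ennreal (c0 + c1)"
      by simp
    then obtain c2 where c2: "b2 = ennreal c2" "0 \<le> c2" "c2 \<le> c0 + c1"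
      using real \<open>0 \<le> c1\<close> by (cases b2) (auto simp: top_unique simp flip: ennreal_plus)
    have "exp (c0 - a0) \<le> 1"
      using assms(1) real by (simp add: exp_ereal_def enn2ereal_ennreal ennreal_le_1)
    then show ?thesis
      using c2 real \<open>b1 = ennreal c1\<close> \<open>0 \<le> c1\<close> assms(2)
      by (auto simp: exp_ereal_def enn2ereal_ennreal intro!: ennreal_leI)
  next
    case top
    then show ?thesis
      using assms(1) by (simp add: exp_ereal_def top_unique)
  qed
next
  case top
  then show ?thesis by (simp add: exp_ereal_def)
qed

section \<open>A degenerate Stieltjes integral\<close>

text \<open>Clamping to a single point makes both Jordan components constant, and their measures
  give \<open>{a}\<close> no mass. This yields the value zero of the discounted loss at time
  zero.\<close>

lemma stieltjes_integral_refl: "stieltjes_integral f g a a = 0"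
proof -
  have "max a (min a x) = a" for x :: real by auto
  moreover have "(LINT x:{a..a} | interval_measure (\<lambda>x. Lim (at_right x) (\<lambda>x. k)). f x) = 0"
    for k :: real
  proof -
    have "(\<lambda>x::real. Lim (at_right x) (\<lambda>x. k)) = (\<lambda>x. k)"
      by (intro ext tendsto_Lim) auto
    moreover have "emeasure (interval_measure (\<lambda>x. k)) {a..a} = 0"
      by (subst emeasure_interval_measure_Icc) auto
    then have "AE x in interval_measure (\<lambda>x. k). indicat_real {a..a} x *\<^sub>R f x = 0"
      by (intro AE_I[of _ _ "{a..a}"]) (auto simp: indicator_def split: if_splits)
    ultimately show ?thesis
      unfolding set_lebesgue_integral_def by (simp only: integral_eq_zero_AE)
  qed
  ultimately show ?thesis
    by (simp add: stieltjes_integral_def)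
qed

section \<open>Maximal inequalities for independent increments\<close>

text \<open>Meant for functions of past and future increments, with values in \<open>ennreal\<close>
  to avoid integrability conditions. \<open>case_bool\<close> turns the pair into a family over
  \<open>bool\<close>, to which the product formula for families applies.\<close>

lemma (in prob_space) nn_integral_indep_var_mult:
  fixes f g :: "'b \<Rightarrow> ennreal"
  assumes ind: "indep_var S X T Y"
    and f [measurable]: "f \<in> borel_measurable S" and g [measurable]: "g \<in> borel_measurable T"
  shows "(\<integral>\<^sup>+ \<omega>. f (X \<omega>) * g (Y \<omega>) \<partial>M) = (\<integral>\<^sup>+ \<omega>. f (X \<omega>) \<partial>M) * (\<integral>\<^sup>+ \<omega>. g (Y \<omega>) \<partial>M)"
proof -
  have "indep_vars (\<lambda>_. borel) (case_bool (f \<circ> X) (g \<circ> Y)) UNIV"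
    using indep_var_compose[OF ind f g] unfolding indep_var_def
    by (rule back_subst[of "\<lambda>M'. indep_vars M' _ _"]) (auto split: bool.split)
  from indep_vars_nn_integral[OF _ this] show ?thesis
    by (simp add: UNIV_bool comp_def mult.commute)
qed

text \<open>Independence of random variables includes their measurability, and the partition
  \<open>0, t, t, ...\<close> has \<open>X t - X 0\<close> as an increment.\<close>

lemma (in prob_space) measurable_process_if_independent_increments:
  assumes "independent_increments M X" "\<And>\<omega>. X 0 \<omega> = 0" "0 \<le> t"
  shows "X t \<in> borel_measurable M"
proof -
  define s where "s i = (if i = 0 then 0 else t)" for i :: nat
  have "mono s" "0 \<le> s 0"
    using \<open>0 \<le> t\<close> by (auto simp: s_def mono_def)
  with assms(1) have "indep_vars (\<lambda>_. borel) (\<lambda>i \<omega>. X (s (Suc i)) \<omega> - X (s i) \<omega>) {..<Suc 0}"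
    unfolding independent_increments_def by blast
  then have "(\<lambda>\<omega>. X (s (Suc 0)) \<omega> - X (s 0) \<omega>) \<in> borel_measurable M"
    by (auto simp: indep_vars_def)
  then show ?thesis
    using assms(2) by (simp add: s_def)
qed

text \<open>Kolmogorov's first-passage argument: with \<open>S k\<close> the partial sums and \<open>A k\<close> the event that
  \<open>k\<close> is the first index with \<open>S k > u\<close>, independence makes the integral of \<open>exp (h * S n)\<close> over \<open>A k\<close>
  equal to that of \<open>exp (h * S k)\<close> times the ratio of the exponential moments of \<open>S n\<close> and \<open>S k\<close>.\<close>

lemma (in prob_space) exp_maximal_inequality_finite:
  fixes X :: "real \<Rightarrow> 'a \<Rightarrow> real" and t :: "nat \<Rightarrow> real" and F :: ennreal
  assumes incr: "independent_increments M X" and X0: "\<And>\<omega>. X 0 \<omega> = 0"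
    and t: "mono t" "t 0 = 0" and "0 \<le> h"
    and F: "\<And>k. k \<le> n \<Longrightarrow> exp_moment M h (X (t k)) \<le> F"
  shows "emeasure M {\<omega> \<in> space M. \<exists>k\<le>n. X (t k) \<omega> > u} \<le> ennreal (exp (- h * u)) * F"
proof (cases "F = \<top>")
  case True
  then show ?thesis by (simp add: ennreal_mult_top)
next
  \<comment> \<open>Finiteness of \<open>F\<close> is what allows \<open>m n\<close> to be cancelled
    at the end.\<close>
  case False
  define S where "S k = X (t k)" for k
  define D where "D i \<omega> = S (Suc i) \<omega> - S i \<omega>" for i \<omega>
  have indep: "indep_vars (\<lambda>_. borel) D {..<n}"
    using incr t unfolding independent_increments_def D_def S_def by auto
  have t_nonneg: "0 \<le> t k" for k
    using monoD[OF t(1), of 0 k] t(2) by simp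
  have S [measurable]: "S k \<in> borel_measurable M" for k
    unfolding S_def using measurable_process_if_independent_increments[OF incr X0 t_nonneg] .
  have S_sum: "S k \<omega> = (\<Sum>i<k. D i \<omega>)" for k \<omega>
    using sum_lessThan_telescope[of "\<lambda>i. S i \<omega>" k] X0 t(2) by (simp add: D_def S_def)
  have S_diff: "S n \<omega> - S k \<omega> = (\<Sum>i\<in>{k..<n}. D i \<omega>)" if "k \<le> n" for k \<omega>
    using sum_Suc_diff'[OF that, of "\<lambda>i. S i \<omega>"] by (simp add: D_def)
  define A where "A k = {\<omega> \<in> space M. (\<forall>j<k. S j \<omega> \<le> u) \<and> u < S k \<omega>}" for k
  have A [measurable]: "A k \<in> sets M" for k
    unfolding A_def by measurable
  define m where "m k = exp_moment M h (S k)" for k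
  have m_F: "m k \<le> F" if "k \<le> n" for k
    using F[OF that] by (simp add: m_def S_def)
  have m_pos: "m k \<noteq> 0" for k
    unfolding m_def exp_moment_def by (subst nn_integral_0_iff_AE) (auto simp: AE_False not_le)
  \<comment> \<open>The first \<open>k\<close> increments are independent of the later ones, whose
    sum is \<open>S n - S k\<close>.\<close>
  have split: "(\<integral>\<^sup>+\<omega>. \<phi> (restrict (\<lambda>i. D i \<omega>) {..<k}) * ennreal (exp (h * (S n \<omega> - S k \<omega>))) \<partial>M)
      = (\<integral>\<^sup>+\<omega>. \<phi> (restrict (\<lambda>i. D i \<omega>) {..<k}) \<partial>M)
        * (\<integral>\<^sup>+\<omega>. ennreal (exp (h * (S n \<omega> - S k \<omega>))) \<partial>M)"
    if "k \<le> n" and \<phi>: "\<phi> \<in> borel_measurable (PiM {..<k} (\<lambda>_. borel))" for k \<phi>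
  proof -
    have "indep_var (PiM {..<k} (\<lambda>_. borel)) (\<lambda>\<omega>. restrict (\<lambda>i. D i \<omega>) {..<k})
                    (PiM {k..<n} (\<lambda>_. borel)) (\<lambda>\<omega>. restrict (\<lambda>i. D i \<omega>) {k..<n})"
      by (rule indep_var_restrict[OF indep]) (use \<open>k \<le> n\<close> in auto)
    from nn_integral_indep_var_mult[OF this \<phi>, of "\<lambda>x. ennreal (exp (h * (\<Sum>i\<in>{k..<n}. x i)))"]
    show ?thesis
      unfolding S_diff[OF \<open>k \<le> n\<close>] by simp
  qed
  \<comment> \<open>The ratio identity is kept in cross-multiplied form to avoid division in
    \<open>ennreal\<close>.\<close>
  have passage: "(\<integral>\<^sup>+\<omega>\<in>A k. ennreal (exp (h * S k \<omega>)) \<partial>M) * m n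
      = (\<integral>\<^sup>+\<omega>\<in>A k. ennreal (exp (h * S n \<omega>)) \<partial>M) * m k" if "k \<le> n" for k
  proof -
    define e where "e = (\<integral>\<^sup>+\<omega>. ennreal (exp (h * (S n \<omega> - S k \<omega>))) \<partial>M)"
    \<comment> \<open>To apply \<open>split\<close>, \<open>exp (h * S k)\<close> and its
      restriction to \<open>A k\<close> are written as functions of the first \<open>k\<close>
      increments alone.\<close>
    define \<phi>1 where "\<phi>1 x = ennreal (exp (h * (\<Sum>i<k. x i)))" for x :: "nat \<Rightarrow> real"
    define \<phi>2 where "\<phi>2 x = \<phi>1 x * (if (\<forall>j<k. (\<Sum>i<j. x i) \<le> u) \<and> u < (\<Sum>i<k. x i) then 1 else 0)"
      for x :: "nat \<Rightarrow> real"
    have [measurable]: "\<phi>1 \<in> borel_measurable (PiM {..<k} (\<lambda>_. borel))"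
      unfolding \<phi>1_def by simp
    have [measurable]: "(\<lambda>x. \<Sum>i<j. x i) \<in> borel_measurable (PiM {..<k} (\<lambda>_. borel :: real measure))"
      if "j \<le> k" for j
      using that by (intro borel_measurable_sum measurable_component_singleton) auto
    have [measurable]: "\<phi>2 \<in> borel_measurable (PiM {..<k} (\<lambda>_. borel))"
    proof -
      have "Measurable.pred (PiM {..<k} (\<lambda>_. borel :: real measure))
          (\<lambda>x. \<forall>j\<in>{..<k}. (\<Sum>i<j. x i) \<le> u)"
        by (intro pred_intros_finite borel_measurable_const borel_measurable_le) auto
      then show ?thesis
        unfolding \<phi>2_def by (simp add: Ball_def)
    qed
    have 1: "\<phi>1 (restrict (\<lambda>i. D i \<omega>) {..<k}) = ennreal (exp (h * S k \<omega>))" for \<omega>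
      by (simp add: \<phi>1_def S_sum)
    have 2: "\<phi>2 (restrict (\<lambda>i. D i \<omega>) {..<k}) = ennreal (exp (h * S k \<omega>)) * indicator (A k) \<omega>"
      if "\<omega> \<in> space M" for \<omega>
    proof -
      have "(\<Sum>i<j. restrict (\<lambda>i. D i \<omega>) {..<k} i) = S j \<omega>" if "j \<le> k" for j
        using that unfolding S_sum by (intro sum.cong) auto
      then show ?thesis
        using that by (auto simp: \<phi>2_def 1 A_def indicator_def)
    qed
    have add: "ennreal (exp (h * S k \<omega>)) * ennreal (exp (h * (S n \<omega> - S k \<omega>))) = ennreal (exp (h * S n \<omega>))"
      for \<omega> by (simp flip: ennreal_mult exp_add add: algebra_simps)
    have "m n = m k * e"
      using split[OF that, of \<phi>1] by (simp add: 1 add m_def exp_moment_def e_def)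
    moreover have "(\<integral>\<^sup>+\<omega>\<in>A k. ennreal (exp (h * S n \<omega>)) \<partial>M)
        = (\<integral>\<^sup>+\<omega>\<in>A k. ennreal (exp (h * S k \<omega>)) \<partial>M) * e"
    proof -
      have "(\<integral>\<^sup>+\<omega>\<in>A k. ennreal (exp (h * S n \<omega>)) \<partial>M)
          = (\<integral>\<^sup>+\<omega>. \<phi>2 (restrict (\<lambda>i. D i \<omega>) {..<k}) * ennreal (exp (h * (S n \<omega> - S k \<omega>))) \<partial>M)"
        by (intro nn_integral_cong) (simp add: 2 mult_ac flip: add)
      also have "\<dots> = (\<integral>\<^sup>+\<omega>. \<phi>2 (restrict (\<lambda>i. D i \<omega>) {..<k}) \<partial>M) * e"
        unfolding e_def by (rule split[OF that]) measurable
      also have "(\<integral>\<^sup>+\<omega>. \<phi>2 (restrict (\<lambda>i. D i \<omega>) {..<k}) \<partial>M)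
          = (\<integral>\<^sup>+\<omega>\<in>A k. ennreal (exp (h * S k \<omega>)) \<partial>M)"
        by (intro nn_integral_cong) (simp add: 2)
      finally show ?thesis .
    qed
    ultimately show ?thesis
      by (simp add: mult_ac)
  qed
  have disj: "disjoint_family_on A {..n}"
    unfolding disjoint_family_on_def
  proof (intro ballI impI)
    fix i j :: nat assume "i \<noteq> j"
    then consider "i < j" | "j < i" by linarith
    then show "A i \<inter> A j = {}"
      by cases (auto simp: A_def not_less[symmetric])
  qed
  have union: "{\<omega> \<in> space M. \<exists>k\<le>n. X (t k) \<omega> > u} = (\<Union>k\<le>n. A k)"
  proof (intro equalityI subsetI)
    fix \<omega> assume "\<omega> \<in> {\<omega> \<in> space M. \<exists>k\<le>n. X (t k) \<omega> > u}"
    then obtain k where k: "\<omega> \<in> space M" "k \<le> n" "u < S k \<omega>"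
      by (auto simp: S_def)
    then obtain k0 where "u < S k0 \<omega>" "\<forall>j<k0. \<not> u < S j \<omega>"
      using exists_least_iff[of "\<lambda>k. u < S k \<omega>"] by blast
    with k have "k0 \<le> n" "\<omega> \<in> A k0"
      by (metis le_trans not_le) (use k \<open>u < S k0 \<omega>\<close> \<open>\<forall>j<k0. \<not> u < S j \<omega>\<close> in \<open>auto simp: A_def\<close>)
    then show "\<omega> \<in> (\<Union>k\<le>n. A k)" by blast
  qed (auto simp: A_def S_def)
  \<comment> \<open>Chernoff's bound on \<open>A k\<close>, where \<open>S k\<close> exceeds
    \<open>u\<close>; passing from \<open>S k\<close> to \<open>S n\<close> trades
    \<open>m n\<close> for \<open>m k\<close>, which \<open>F\<close> dominates.\<close>
  have A_bound: "emeasure M (A k) * m n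
      \<le> ennreal (exp (- h * u)) * F * (\<integral>\<^sup>+\<omega>\<in>A k. ennreal (exp (h * S n \<omega>)) \<partial>M)" if "k \<le> n" for k
  proof -
    have "emeasure M (A k) = (\<integral>\<^sup>+\<omega>. indicator (A k) \<omega> \<partial>M)" by simp
    also have "\<dots> \<le> (\<integral>\<^sup>+\<omega>. ennreal (exp (- h * u)) * (ennreal (exp (h * S k \<omega>)) * indicator (A k) \<omega>) \<partial>M)"
    proof (intro nn_integral_mono)
      fix \<omega> show "indicator (A k) \<omega> \<le> ennreal (exp (- h * u)) * (ennreal (exp (h * S k \<omega>)) * indicator (A k) \<omega>)"
      proof (cases "\<omega> \<in> A k")
        case True
        then have "0 \<le> h * (S k \<omega> - u)"
          using \<open>0 \<le> h\<close> by (auto simp: A_def)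
        then have "1 \<le> exp (- h * u) * exp (h * S k \<omega>)"
          by (simp add: algebra_simps flip: exp_add)
        then show ?thesis
          using True by (simp flip: ennreal_mult)
      qed simp
    qed
    also have "\<dots> = ennreal (exp (- h * u)) * (\<integral>\<^sup>+\<omega>\<in>A k. ennreal (exp (h * S k \<omega>)) \<partial>M)"
      by (intro nn_integral_cmult) simp
    finally have "emeasure M (A k) * m n
        \<le> ennreal (exp (- h * u)) * (\<integral>\<^sup>+\<omega>\<in>A k. ennreal (exp (h * S k \<omega>)) \<partial>M) * m n"
      by (rule mult_right_mono) simp
    also have "\<dots> = ennreal (exp (- h * u)) * (\<integral>\<^sup>+\<omega>\<in>A k. ennreal (exp (h * S n \<omega>)) \<partial>M) * m k"
      using passage[OF that] by (simp add: mult.assoc)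
    also have "\<dots> \<le> ennreal (exp (- h * u)) * (\<integral>\<^sup>+\<omega>\<in>A k. ennreal (exp (h * S n \<omega>)) \<partial>M) * F"
      by (intro mult_left_mono m_F that) simp
    finally show ?thesis by (simp add: mult_ac)
  qed
  \<comment> \<open>Summing over the disjoint \<open>A k\<close> leaves at most the full moment
    \<open>m n\<close> on the right; being neither zero nor infinite, it cancels.\<close>
  have "emeasure M (\<Union>k\<le>n. A k) * m n = (\<Sum>k\<le>n. emeasure M (A k) * m n)"
    using disj by (subst sum_emeasure[symmetric]) (auto simp: sum_distrib_right)
  also have "\<dots> \<le> (\<Sum>k\<le>n. ennreal (exp (- h * u)) * F * (\<integral>\<^sup>+\<omega>\<in>A k. ennreal (exp (h * S n \<omega>)) \<partial>M))"
    by (intro sum_mono A_bound) simp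
  also have "\<dots> = ennreal (exp (- h * u)) * F * (\<integral>\<^sup>+\<omega>. (\<Sum>k\<le>n. ennreal (exp (h * S n \<omega>)) * indicator (A k) \<omega>) \<partial>M)"
    by (subst nn_integral_sum) (auto simp: sum_distrib_left)
  also have "\<dots> \<le> ennreal (exp (- h * u)) * F * m n"
    unfolding m_def exp_moment_def
  proof (intro mult_left_mono nn_integral_mono)
    fix \<omega>
    have "(\<Sum>k\<le>n. indicator (A k) \<omega>) = (indicator (\<Union>k\<le>n. A k) \<omega> :: ennreal)"
      using disj by (subst indicator_UN_disjoint) auto
    then show "(\<Sum>k\<le>n. ennreal (exp (h * S n \<omega>)) * indicator (A k) \<omega>) \<le> ennreal (exp (h * S n \<omega>))"
      by (simp add: indicator_def flip: sum_distrib_left)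
  qed simp
  finally have "emeasure M (\<Union>k\<le>n. A k) * m n \<le> ennreal (exp (- h * u)) * F * m n" .
  moreover have "m n \<noteq> \<top>"
    using m_F[of n] False by (auto simp: top_unique)
  ultimately show ?thesis
    unfolding union
    using ennreal_mult_le_mult_iff[of "m n"] m_pos[of n] by (simp add: mult.commute[of _ "m n"])
qed

text \<open>The set of times is exhausted by finite sets, and the finite inequality passes to the
  limit by continuity from below.\<close>

lemma (in prob_space) exp_maximal_inequality_countable:
  fixes X :: "real \<Rightarrow> 'a \<Rightarrow> real"
  assumes incr: "independent_increments M X" and X0: "\<And>\<omega>. X 0 \<omega> = 0"
    and C: "countable C" "0 \<in> C" "C \<subseteq> {0..}" and "0 \<le> h"
    and F: "\<And>t. t \<in> C \<Longrightarrow> exp_moment M h (X t) \<le> F"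
  shows "emeasure M {\<omega> \<in> space M. \<exists>t\<in>C. X t \<omega> > u} \<le> ennreal (exp (- h * u)) * F"
proof -
  define E where "E T = {\<omega> \<in> space M. \<exists>t\<in>T. X t \<omega> > u}" for T
  \<comment> \<open>Every stage contains \<open>0\<close>, where the time sequence of the finite
    inequality has to start.\<close>
  define B where "B n = insert 0 (from_nat_into C ` {..n})" for n
  have B: "finite (B n)" "B n \<subseteq> C" for n
    using C from_nat_into[of C] by (auto simp: B_def)
  have "E (B n) \<in> sets M" for n
  proof -
    have [measurable]: "X t \<in> borel_measurable M" if "t \<in> B n" for t
      using measurable_process_if_independent_increments[OF incr X0] that B(2) C(3) by auto
    show ?thesis
      unfolding E_def by (rule sets.sets_Collect_finite_Ex[OF _ B(1)]) measurable
  qed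
  moreover have "incseq (\<lambda>n. E (B n))"
    unfolding incseq_def E_def B_def by fastforce
  ultimately have "emeasure M (\<Union>n. E (B n)) = (SUP n. emeasure M (E (B n)))"
    by (subst SUP_emeasure_incseq) auto
  moreover have "(\<Union>n. E (B n)) = E C"
  proof -
    have "s \<in> B (to_nat_on C s)" if "s \<in> C" for s
      using from_nat_into_to_nat_on[OF C(1) that] by (force simp: B_def)
    then show ?thesis
      using B(2) unfolding E_def by blast
  qed
  moreover have "emeasure M (E (B n)) \<le> ennreal (exp (- h * u)) * F" for n
  proof -
    define xs where "xs = sorted_list_of_set (B n)"
    have xs: "set xs = B n" "sorted xs"
      using B(1)[of n] by (simp_all add: xs_def)
    then have "xs \<noteq> []"
      by (auto simp: B_def)
    \<comment> \<open>The finite inequality expects a monotone sequence on all naturals, so the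
      sorted list is continued by its last entry; the index \<open>length xs\<close> merely repeats
      that entry.\<close>
    define t where "t k = xs ! min k (length xs - 1)" for k
    have t_in: "t k \<in> B n" for k
      using xs \<open>xs \<noteq> []\<close> by (auto simp: t_def simp flip: xs(1) intro!: nth_mem min.strict_coboundedI2)
    have "mono t"
      using xs \<open>xs \<noteq> []\<close> by (auto simp: t_def mono_def intro!: sorted_nth_mono min.strict_coboundedI2)
    moreover have "t 0 = 0"
    proof -
      have "0 \<in> set xs" using xs by (simp add: B_def)
      then obtain i where "i < length xs" "xs ! i = 0" by (auto simp: in_set_conv_nth)
      then have "xs ! 0 \<le> 0" using sorted_nth_mono[OF xs(2), of 0 i] by auto
      moreover have "0 \<le> t 0" using t_in[of 0] B(2)[of n] C(3) by auto
      ultimately show ?thesis by (simp add: t_def)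
    qed
    ultimately have "emeasure M {\<omega> \<in> space M. \<exists>k\<le>length xs. X (t k) \<omega> > u} \<le> ennreal (exp (- h * u)) * F"
      using t_in B(2) by (intro exp_maximal_inequality_finite[OF incr X0] \<open>0 \<le> h\<close> F) auto
    also have "{\<omega> \<in> space M. \<exists>k\<le>length xs. X (t k) \<omega> > u} = E (B n)"
    proof -
      have "\<exists>k\<le>length xs. s = t k" if "s \<in> B n" for s
      proof -
        from that obtain k where k: "k < length xs" "xs ! k = s"
          unfolding xs(1)[symmetric] in_set_conv_nth by auto
        then have "s = t k" by (simp add: t_def min_absorb1)
        with k show ?thesis using less_imp_le by blast
      qed
      then show ?thesis
        using t_in unfolding E_def by blast
    qed
    finally show ?thesis .
  qed
  ultimately show ?thesis
    unfolding E_def by (simp add: SUP_le_iff)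
qed

section \<open>From countably many times to an interval\<close>

text \<open>Separability is applied to \<open>{..u}\<close>: off the null set, a value above
  \<open>u\<close> before time \<open>b\<close> forces one at a time of \<open>D\<close> before
  \<open>b\<close>. As only open intervals are covered, a right end point has to be adjoined;
  \<open>0\<close> is adjoined for the maximal inequality.\<close>

lemma separable_process_countable_exceedance:
  fixes X :: "real \<Rightarrow> 'a \<Rightarrow> real"
  assumes "separable_process M X" and I: "I = {0..} \<or> (\<exists>T\<ge>0. I = {0..T})"
  obtains C K where "countable C" "0 \<in> C" "C \<subseteq> I" "K \<in> null_sets M"
    "\<forall>\<omega>\<in>space M - K. \<forall>t\<in>I. \<forall>u<X t \<omega>. \<exists>s\<in>C. u < X s \<omega>"
proof -
  obtain D K where D: "countable D" "D \<subseteq> {0..}" and K: "K \<in> null_sets M"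
    and sep: "\<forall>a b A. closed A \<and> is_interval A \<longrightarrow>
        {\<omega> \<in> space M. \<forall>t\<in>{a<..<b} \<inter> D. X t \<omega> \<in> A}
          - {\<omega> \<in> space M. \<forall>t\<in>{a<..<b} \<inter> {0..}. X t \<omega> \<in> A} \<subseteq> K"
    using assms(1) unfolding separable_process_def by (elim exE conjE) (rule that)
  have ex: "\<exists>s\<in>D. s < b \<and> u < X s \<omega>"
    if "\<omega> \<in> space M" "\<omega> \<notin> K" "0 \<le> t" "t < b" "u < X t \<omega>" for \<omega> t b u
  proof (rule ccontr)
    assume "\<not> ?thesis"
    \<comment> \<open>The negative left end \<open>-1\<close> makes time \<open>0\<close> an
      interior point of the open interval.\<close>
    then have "\<omega> \<in> {\<omega> \<in> space M. \<forall>t\<in>{-1<..<b} \<inter> D. X t \<omega> \<in> {..u}}"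
      using that by (auto simp: not_less)
    moreover have "\<omega> \<notin> {\<omega> \<in> space M. \<forall>t\<in>{-1<..<b} \<inter> {0..}. X t \<omega> \<in> {..u}}"
      using that by force
    ultimately show False
      using sep[rule_format, of "{..u}" "-1" b] \<open>\<omega> \<notin> K\<close>
      by (simp only: closed_atMost is_interval_ic) blast
  qed
  from I show thesis
  proof (elim disjE exE conjE)
    assume I: "I = {0..}"
    show thesis
    proof (rule that[of "insert 0 D" K])
      show "\<forall>\<omega>\<in>space M - K. \<forall>t\<in>I. \<forall>u<X t \<omega>. \<exists>s\<in>insert 0 D. u < X s \<omega>"
      proof (intro ballI allI impI)
        fix \<omega> t u assume "\<omega> \<in> space M - K" "t \<in> I" "u < X t \<omega>"
        then show "\<exists>s\<in>insert 0 D. u < X s \<omega>"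
          using ex[of \<omega> t "t + 1" u] I by auto
      qed
    qed (use D K I in auto)
  next
    \<comment> \<open>Points of \<open>D\<close> beyond \<open>T\<close> must be discarded, while
      the value at \<open>T\<close> is not controlled by earlier times.\<close>
    fix T :: real assume T: "0 \<le> T" and I: "I = {0..T}"
    show thesis
    proof (rule that[of "insert 0 (insert T (D \<inter> {..<T}))" K])
      show "\<forall>\<omega>\<in>space M - K. \<forall>t\<in>I. \<forall>u<X t \<omega>.
          \<exists>s\<in>insert 0 (insert T (D \<inter> {..<T})). u < X s \<omega>"
      proof (intro ballI allI impI)
        fix \<omega> t u assume "\<omega> \<in> space M - K" "t \<in> I" "u < X t \<omega>"
        then show "\<exists>s\<in>insert 0 (insert T (D \<inter> {..<T})). u < X s \<omega>"
          using ex[of \<omega> t T u] I by (cases "t = T") auto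
      qed
    qed (use D K I T in auto)
  qed
qed

text \<open>A supremum is strictly above \<open>u\<close> exactly when some value is. Hence the
  events over \<open>I\<close> and over the countable \<open>C\<close> differ by a subset of a null
  set, which gives measurability for the completion and transfers the countable inequality.\<close>

lemma (in prob_space) sup_exceedance_maximal_inequality:
  fixes X :: "real \<Rightarrow> 'a \<Rightarrow> real"
  assumes incr: "independent_increments M X" and X0: "\<And>\<omega>. X 0 \<omega> = 0"
    and sep: "separable_process M X" and I: "I = {0..} \<or> (\<exists>T\<ge>0. I = {0..T})"
  shows sup_exceedance_sets: "{\<omega> \<in> space M. (SUP t\<in>I. ereal (X t \<omega>)) > ereal u} \<in> sets (completion M)"
    and sup_exceedance_prob_le: "0 \<le> h \<Longrightarrow>
      sup_exceedance_prob M X I u \<le> ennreal (exp (- h * u)) * (SUP t\<in>I. exp_moment M h (X t))"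
proof -
  obtain C K where C: "countable C" "0 \<in> C" "C \<subseteq> I" and K: "K \<in> null_sets M"
    and ex: "\<forall>\<omega>\<in>space M - K. \<forall>t\<in>I. \<forall>u<X t \<omega>. \<exists>s\<in>C. u < X s \<omega>"
    by (rule separable_process_countable_exceedance[OF sep I]) (rule that)
  define E where "E = {\<omega> \<in> space M. (SUP t\<in>I. ereal (X t \<omega>)) > ereal u}"
  define E' where "E' = {\<omega> \<in> space M. \<exists>t\<in>C. X t \<omega> > u}"
  have C_nonneg: "C \<subseteq> {0..}"
    using C(3) I by auto
  have [measurable]: "X t \<in> borel_measurable M" if "t \<in> C" for t
    using measurable_process_if_independent_increments[OF incr X0] that C_nonneg by auto
  have E': "E' \<in> sets M"
    unfolding E'_def by (rule sets.sets_Collect_countable_Ex'[OF _ C(1)]) measurable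
  have sub: "E' \<subseteq> E" "E - E' \<subseteq> K"
    using C(3) ex unfolding E_def E'_def less_SUP_iff by (auto simp: less_SUP_iff)
  have diff: "E - E' \<in> null_sets (completion M)"
    using sub(2) K null_sets_completion_iff2 by blast
  have "E = E' \<union> (E - E')"
    using sub(1) by blast
  then have E: "E \<in> sets (completion M)"
    using E' diff by (metis null_setsD2 sets.Un sets_completionI_sets)
  then show "{\<omega> \<in> space M. (SUP t\<in>I. ereal (X t \<omega>)) > ereal u} \<in> sets (completion M)"
    by (simp add: E_def)
  assume "0 \<le> h"
  have "emeasure (completion M) E = emeasure (completion M) E'"
    using emeasure_Un_null_set[of E' "completion M" "E - E'"] E' diff \<open>E = E' \<union> (E - E')\<close> by simp
  also have "\<dots> = emeasure M E'"
    using E' by simp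
  also have "\<dots> \<le> ennreal (exp (- h * u)) * (SUP t\<in>I. exp_moment M h (X t))"
    unfolding E'_def
    using C by (intro exp_maximal_inequality_countable[OF incr X0 C(1,2) C_nonneg \<open>0 \<le> h\<close>] SUP_upper) auto
  finally show "sup_exceedance_prob M X I u
      \<le> ennreal (exp (- h * u)) * (SUP t\<in>I. exp_moment M h (X t))"
    by (simp add: sup_exceedance_prob_def E_def)
qed

section \<open>Discounted loss and ruin in the risk model\<close>

lemma (in interest_risk_model_standing) discounted_loss_zero: "discounted_loss r p q 0 \<omega> = 0"
  by (simp add: discounted_loss_def stieltjes_integral_refl)

text \<open>On the half line the discount factor is at most one, so \<open>h * p' x\<close>
  dominates in absolute value. The factor is measurable there because \<open>r\<close> is
  monotone.\<close>

lemma (in interest_risk_model_standing) discounted_premium_integrable: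
  "set_integrable lborel {0..b} (\<lambda>x. h * exp (- r x) * p' x)"
proof (cases "0 \<le> b")
  case True
  have int: "integrable lborel (\<lambda>x. h * (indicat_real {0..b} x * p' x))"
    using premium_density True
    by (auto simp: has_density_on_half_line_def set_integrable_def)
  have "(\<lambda>x. exp (- r x)) \<in> borel_measurable (restrict_space borel {0..})"
    by (intro measurable_compose[OF borel_measurable_mono_on_fnc[OF interest_mono]]) auto
  then have exp_r: "(\<lambda>x. indicat_real {0..} x * exp (- r x)) \<in> borel_measurable lborel"
    by (subst (asm) borel_measurable_restrict_space_iff) auto
  have "(\<lambda>x. (indicat_real {0..} x * exp (- r x)) * (h * (indicat_real {0..b} x * p' x)))
      \<in> borel_measurable lborel"
    by (rule borel_measurable_times[OF exp_r borel_measurable_integrable[OF int]])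
  also have "(\<lambda>x. (indicat_real {0..} x * exp (- r x)) * (h * (indicat_real {0..b} x * p' x)))
      = (\<lambda>x. indicat_real {0..b} x *\<^sub>R (h * exp (- r x) * p' x))"
    by (auto simp: fun_eq_iff split: split_indicator)
  finally have meas: "(\<lambda>x. indicat_real {0..b} x *\<^sub>R (h * exp (- r x) * p' x)) \<in> borel_measurable lborel" .
  have r: "0 \<le> r x" if "0 \<le> x" for x
    using mono_onD[OF interest_mono, of 0 x] that interest_zero by simp
  have bound: "\<bar>h * exp (- r x) * p' x\<bar> \<le> \<bar>h * p' x\<bar>" if "0 \<le> x" for x
    using r[OF that] by (auto simp: abs_mult intro!: mult_left_le mult_right_mono)
  show ?thesis
    unfolding set_integrable_def
    by (intro Bochner_Integration.integrable_bound[OF int meas] AE_I2)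
       (use bound in \<open>auto split: split_indicator\<close>)
qed (simp add: set_integrable_def)

lemma (in interest_risk_model_standing) exp_moment_discounted_loss_shift_le:
  assumes "0 < l" "0 \<le> h" "0 \<le> t"
    and periodic: "\<And>t. 0 \<le> t \<Longrightarrow> distr M borel (Z (t + l)) = distr M borel (Z t)"
    and intensity: "\<And>t. 0 \<le> t \<Longrightarrow> exp (- r (t + l)) * \<Lambda>' (t + l) \<le> exp (- r t) * \<Lambda>' t"
    and premium: "\<And>t. 0 \<le> t \<Longrightarrow> exp (- r (t + l)) * p' (t + l) \<ge> exp (- r t) * p' t"
    and le1: "exp_moment M h (discounted_loss r p q l) \<le> 1"
  shows "exp_moment M h (discounted_loss r p q (t + l)) \<le> exp_moment M h (discounted_loss r p q t)"
proof (cases "t = 0")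
  \<comment> \<open>The moment formula covers positive times only; at time zero the moment is one
    and \<open>le1\<close> is the required bound.\<close>
  case True
  then show ?thesis
    using le1 by (simp add: discounted_loss_zero exp_moment_def emeasure_space_1)
next
  case False
  define f where "f x = (exp_moment M (h * exp (- r x)) (Z x) - 1) * ennreal (\<Lambda>' x)" for x
  have f_shift: "f (x + l) \<le> f x" if "0 \<le> x" for x
  proof -
    \<comment> \<open>The extra discounting over one period; it is at most one because
      \<open>r\<close> is monotone, so the convexity bound applies.\<close>
    define c where "c = exp (- (r (x + l) - r x))"
    have c: "0 \<le> c" "c \<le> 1"
      using mono_onD[OF interest_mono, of x "x + l"] that \<open>0 < l\<close> by (auto simp: c_def)
    have [measurable]: "Z x \<in> borel_measurable M" "Z (x + l) \<in> borel_measurable M"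
      using claim_size_measurable that \<open>0 < l\<close> by auto
    have "exp_moment M k (Z (x + l)) = exp_moment M k (Z x)" for k
    proof -
      have "exp_moment M k X = (\<integral>\<^sup>+ y. ennreal (exp (k * y)) \<partial>distr M borel X)"
        if [measurable]: "X \<in> borel_measurable M" for X
        unfolding exp_moment_def by (subst nn_integral_distr) auto
      then show ?thesis
        using periodic[OF that] by simp
    qed
    moreover have "h * exp (- r (x + l)) = c * (h * exp (- r x))"
      by (simp add: c_def flip: exp_add)
    ultimately have "f (x + l) = (exp_moment M (c * (h * exp (- r x))) (Z x) - 1) * ennreal (\<Lambda>' (x + l))"
      by (simp only: f_def)
    also have "\<dots> \<le> ennreal c * (exp_moment M (h * exp (- r x)) (Z x) - 1) * ennreal (\<Lambda>' (x + l))"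
      by (intro mult_right_mono exp_moment_minus_one_mult_le c) auto
    also have "\<dots> = (exp_moment M (h * exp (- r x)) (Z x) - 1) * ennreal (c * \<Lambda>' (x + l))"
      using c by (simp add: ennreal_mult' mult_ac)
    also have "\<dots> \<le> f x"
    proof -
      \<comment> \<open>The intensity condition absorbs the factor \<open>c\<close> released by
        convexity.\<close>
      have "c * \<Lambda>' (x + l) = exp (r x) * (exp (- r (x + l)) * \<Lambda>' (x + l))"
        by (simp add: c_def exp_diff exp_minus field_simps)
      also have "\<dots> \<le> exp (r x) * (exp (- r x) * \<Lambda>' x)"
        using intensity[OF that] by (intro mult_left_mono) auto
      also have "\<dots> = \<Lambda>' x"
        by (simp add: exp_minus)
      finally show ?thesis
        unfolding f_def by (intro mult_left_mono ennreal_leI) auto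
    qed
    finally show ?thesis .
  qed
  have formula: "exp_moment M h (discounted_loss r p q s) =
      exp_ereal (- ereal (LBINT x:{0..s}. h * exp (- r x) * p' x)
        + enn2ereal (\<integral>\<^sup>+ x\<in>{0..s}. f x \<partial>lborel))" if "0 < s" for s
    unfolding f_def by (rule exp_moment_formula[OF \<open>0 \<le> h\<close> that])
  have premiums: "(LBINT x:{0..l}. h * exp (- r x) * p' x) + (LBINT x:{0..t}. h * exp (- r x) * p' x)
      \<le> (LBINT x:{0..t + l}. h * exp (- r x) * p' x)"
    using assms
    by (intro set_integral_shift_superadditive discounted_premium_integrable)
       (auto simp: mult.assoc intro!: mult_left_mono premium)
  have claims: "(\<integral>\<^sup>+ x\<in>{0..t + l}. f x \<partial>lborel)
      \<le> (\<integral>\<^sup>+ x\<in>{0..l}. f x \<partial>lborel) + (\<integral>\<^sup>+ x\<in>{0..t}. f x \<partial>lborel)"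
    using integrand_measurable[OF \<open>0 \<le> h\<close>] assms(1,3) f_shift
    by (intro nn_integral_shift_subadditive) (auto simp: f_def[abs_def])
  have "0 < t" "0 < t + l"
    using False assms(1,3) by auto
  show ?thesis
    unfolding formula[OF \<open>0 < t\<close>] formula[OF \<open>0 < t + l\<close>]
    by (rule exp_ereal_le_of_split[OF le1[unfolded formula[OF \<open>0 < l\<close>]] premiums claims])
qed

text \<open>Whole periods are removed one at a time: \<open>n\<close> counts those contained in
  \<open>t\<close>, and the remainder \<open>s\<close> lies in the first period.\<close>

lemma SUP_half_line_eq_SUP_period:
  fixes f :: "real \<Rightarrow> 'b :: complete_lattice"
  assumes "0 < l" and shift: "\<And>t. 0 \<le> t \<Longrightarrow> f (t + l) \<le> f t"
  shows "(SUP t\<in>{0..}. f t) = (SUP t\<in>{0..l}. f t)"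
proof (rule antisym[OF SUP_least])
  fix t :: real assume "t \<in> {0..}"
  define n where "n = nat \<lfloor>t / l\<rfloor>"
  define s where "s = t - real n * l"
  have n: "real n \<le> t / l" "t / l < real n + 1"
    using \<open>t \<in> {0..}\<close> \<open>0 < l\<close> by (auto simp: n_def)
  then have s: "s \<in> {0..l}"
    using \<open>0 < l\<close> by (auto simp: s_def field_simps)
  have "f (s + real k * l) \<le> f s" for k
  proof (induction k)
    case (Suc k)
    have "f (s + real k * l + l) \<le> f (s + real k * l)"
      using s \<open>0 < l\<close> by (intro shift) auto
    with Suc show ?case
      by (simp add: algebra_simps)
  qed simp
  from this[of n] have "f t \<le> f s"
    by (simp add: s_def)
  also have "\<dots> \<le> (SUP t\<in>{0..l}. f t)"
    using s by (rule SUP_upper)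
  finally show "f t \<le> (SUP t\<in>{0..l}. f t)" .
qed (auto intro: SUP_subset_mono)

text \<open>Almost surely the reserve starts at \<open>u > 0\<close>, so ruin happens at a positive
  time; there the bound on the discounted reserve turns a negative reserve into a discounted loss
  above \<open>u\<close>.\<close>

lemma (in interest_risk_model_standing) ruin_le_sup_exceedance:
  assumes "0 < u" and I: "I = {0..} \<or> (\<exists>T\<ge>0. I = {0..T})"
  shows "emeasure (completion M) (ruin_event M (R u) I)
      \<le> sup_exceedance_prob M (discounted_loss r p q) I u"
  unfolding sup_exceedance_prob_def
proof (rule emeasure_mono_AE)
  show "{\<omega> \<in> space M. (SUP t\<in>I. ereal (discounted_loss r p q t \<omega>)) > ereal u} \<in> sets (completion M)"
    by (rule sup_exceedance_sets[OF indep_increments discounted_loss_zero separable I])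
  have "AE \<omega> in M. \<omega> \<in> ruin_event M (R u) I
      \<longrightarrow> \<omega> \<in> {\<omega> \<in> space M. (SUP t\<in>I. ereal (discounted_loss r p q t \<omega>)) > ereal u}"
    using reserve_initial[OF \<open>0 < u\<close>] discounted_reserve_bound[OF \<open>0 < u\<close>]
  proof eventually_elim
    fix \<omega> assume R0: "R u 0 \<omega> = u"
      and bound: "\<forall>t>0. exp (- r t) * R u t \<omega> \<ge> u - discounted_loss r p q t \<omega>"
    show "\<omega> \<in> ruin_event M (R u) I
      \<longrightarrow> \<omega> \<in> {\<omega> \<in> space M. (SUP t\<in>I. ereal (discounted_loss r p q t \<omega>)) > ereal u}"
    proof
      assume "\<omega> \<in> ruin_event M (R u) I"
      then obtain t where \<omega>: "\<omega> \<in> space M" and t: "t \<in> I" "R u t \<omega> < 0"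
        by (auto simp: ruin_event_def INF_less_iff)
      have "0 \<le> t" using t(1) I by auto
      moreover have "t \<noteq> 0" using t(2) R0 \<open>0 < u\<close> by auto
      ultimately have "u - discounted_loss r p q t \<omega> \<le> exp (- r t) * R u t \<omega>"
        using bound by simp
      also have "\<dots> < 0"
        using t(2) by (simp add: mult_less_0_iff)
      finally show "\<omega> \<in> {\<omega> \<in> space M. (SUP t\<in>I. ereal (discounted_loss r p q t \<omega>)) > ereal u}"
        using \<omega> t(1) by (auto simp: less_SUP_iff)
    qed
  qed
  then show "AE \<omega> in completion M. \<omega> \<in> ruin_event M (R u) I
      \<longrightarrow> \<omega> \<in> {\<omega> \<in> space M. (SUP t\<in>I. ereal (discounted_loss r p q t \<omega>)) > ereal u}"
    by (rule AE_completion)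
qed

theorem corollary3p2:
  fixes M :: "'a measure"
    and N :: "real \<Rightarrow> 'a \<Rightarrow> nat"
    and Z q Y :: "real \<Rightarrow> 'a \<Rightarrow> real"
    and \<Lambda> \<Lambda>' p p' r :: "real \<Rightarrow> real"
    and \<alpha> \<beta> :: "real \<Rightarrow> real \<Rightarrow> real \<Rightarrow> 'a \<Rightarrow> real"
    and R :: "real \<Rightarrow> real \<Rightarrow> 'a \<Rightarrow> real"
    and l :: real
    and L :: ereal
  assumes model: "interest_risk_model_standing M N \<Lambda> Z p q r \<alpha> \<beta> R \<Lambda>' p'"
    and l_pos: "0 < l"
    and periodic: "\<And>t. 0 \<le> t \<Longrightarrow> distr M borel (Z (t + l)) = distr M borel (Z t)"
    and intensity: "\<And>t. 0 \<le> t \<Longrightarrow> exp (- r (t + l)) * \<Lambda>' (t + l) \<le> exp (- r t) * \<Lambda>' t"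
    and premium: "\<And>t. 0 \<le> t \<Longrightarrow> exp (- r (t + l)) * p' (t + l) \<ge> exp (- r t) * p' t"
    and Y_eq: "Y = discounted_loss r p q"
    and L_eq: "L = (SUP h\<in>{h. 0 \<le> h \<and> exp_moment M h (Y l) \<le> 1}. ereal h)"
  shows "(\<forall>h. 0 \<le> h \<and> ereal h \<le> L \<longrightarrow>
            (SUP t\<in>{0..}. exp_moment M h (Y t)) = (SUP t\<in>{0..l}. exp_moment M h (Y t)) \<and>
            (\<forall>u>0. \<forall>T\<ge>0.
               ruin_prob_upto M (R u) T \<le> sup_exceedance_prob M Y {0..T} u \<and>
               sup_exceedance_prob M Y {0..T} u
                 \<le> ennreal (exp (- h * u)) * (SUP t\<in>{0..T}. exp_moment M h (Y t))) \<and>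
            (\<forall>u>0.
               ruin_prob M (R u) \<le> sup_exceedance_prob M Y {0..} u \<and>
               sup_exceedance_prob M Y {0..} u
                 \<le> ennreal (exp (- h * u)) * (SUP t\<in>{0..l}. exp_moment M h (Y t))))
       \<and> (\<forall>u>0.
            ruin_prob M (R u) \<le>
              (INF h\<in>{h. 0 \<le> h \<and> ereal h \<le> L}.
                 ennreal (exp (- h * u)) * (SUP t\<in>{0..l}. exp_moment M h (Y t))) \<and>
            (L \<noteq> \<infinity> \<longrightarrow>
              (INF h\<in>{h. 0 \<le> h \<and> ereal h \<le> L}.
                 ennreal (exp (- h * u)) * (SUP t\<in>{0..l}. exp_moment M h (Y t)))
              \<le> (SUP t\<in>{0..l}. exp_moment M (real_of_ereal L) (Y t))
                  * ennreal (exp (- real_of_ereal L * u))))"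
proof -
  interpret interest_risk_model_standing M N \<Lambda> Z p q r \<alpha> \<beta> R \<Lambda>' p'
    by (rule model)
  have Y0: "Y 0 \<omega> = 0" for \<omega>
    by (simp add: Y_eq discounted_loss_zero)
  have incr: "independent_increments M Y" and sep: "separable_process M Y"
    using indep_increments separable by (simp_all add: Y_eq)
  have Y_l: "Y l \<in> borel_measurable M"
    using measurable_process_if_independent_increments[OF incr Y0] l_pos by simp
  have period: "(SUP t\<in>{0..}. exp_moment M h (Y t)) = (SUP t\<in>{0..l}. exp_moment M h (Y t))"
    if "0 \<le> h" "ereal h \<le> L" for h
  proof (rule SUP_half_line_eq_SUP_period[OF l_pos])
    fix t :: real assume "0 \<le> t"
    \<comment> \<open>The end point \<open>h = L\<close> is included because the supremum is
      attained when finite.\<close>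
    have "exp_moment M h (Y l) \<le> 1"
      using exp_moment_le_one_upto_Sup[OF Y_l] that by (simp add: L_eq)
    then show "exp_moment M h (Y (t + l)) \<le> exp_moment M h (Y t)"
      unfolding Y_eq
      using exp_moment_discounted_loss_shift_le[OF l_pos \<open>0 \<le> h\<close> \<open>0 \<le> t\<close> periodic intensity premium]
      by simp
  qed
  have finite_horizon:
    "ruin_prob_upto M (R u) T \<le> sup_exceedance_prob M Y {0..T} u"
    "0 \<le> h \<Longrightarrow> sup_exceedance_prob M Y {0..T} u
      \<le> ennreal (exp (- h * u)) * (SUP t\<in>{0..T}. exp_moment M h (Y t))"
    if "0 < u" "0 \<le> T" for u T h
    using ruin_le_sup_exceedance[OF \<open>0 < u\<close>, of "{0..T}"]
      sup_exceedance_prob_le[OF incr Y0 sep, of "{0..T}" h u] that(2)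
    by (auto simp: ruin_prob_upto_def Y_eq)
  have infinite_horizon:
    "ruin_prob M (R u) \<le> sup_exceedance_prob M Y {0..} u" if "0 < u" for u
    using ruin_le_sup_exceedance[OF that, of "{0..}"] by (simp add: ruin_prob_def Y_eq)
  have exceedance: "sup_exceedance_prob M Y {0..} u
      \<le> ennreal (exp (- h * u)) * (SUP t\<in>{0..l}. exp_moment M h (Y t))"
    if "0 \<le> h" "ereal h \<le> L" for u h
    using sup_exceedance_prob_le[OF incr Y0 sep, of "{0..}" h u] that by (simp add: period)
  \<comment> \<open>The parameter \<open>0\<close> is always admissible, so \<open>L\<close> is a
    nonnegative real unless it is infinite.\<close>
  have "0 \<le> L"
    unfolding L_eq by (rule SUP_upper2[of 0]) (auto simp: exp_moment_zero prob_space_axioms)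
  then have L_real: "0 \<le> real_of_ereal L" "ereal (real_of_ereal L) = L" if "L \<noteq> \<infinity>"
    using that by (cases L; simp)+
  show ?thesis
  proof (intro conjI allI impI)
    fix u :: real assume "0 < u"
    show "ruin_prob M (R u) \<le> (INF h\<in>{h. 0 \<le> h \<and> ereal h \<le> L}.
        ennreal (exp (- h * u)) * (SUP t\<in>{0..l}. exp_moment M h (Y t)))"
      using order_trans[OF infinite_horizon[OF \<open>0 < u\<close>] exceedance] by (intro INF_greatest) auto
    assume "L \<noteq> \<infinity>"
    \<comment> \<open>The infimum ranges over \<open>h = L\<close> as well, and this choice gives
      the bound with the constant \<open>C_2\<close>.\<close>
    then show "(INF h\<in>{h. 0 \<le> h \<and> ereal h \<le> L}.
        ennreal (exp (- h * u)) * (SUP t\<in>{0..l}. exp_moment M h (Y t)))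
      \<le> (SUP t\<in>{0..l}. exp_moment M (real_of_ereal L) (Y t)) * ennreal (exp (- real_of_ereal L * u))"
      using L_real by (intro INF_lower2[of "real_of_ereal L"]) (auto simp: mult.commute)
  qed (use period finite_horizon infinite_horizon exceedance in blast)+
qed

end
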